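(* For every $n\ge 1$, there is an automaton $\mathcal{A}_n$ with $n$ states and $2^{n^2}$ events, all of which are observable, for which Algorithm 1 (semigroup-based IFO verification) needs at least $2^{n^2}$ steps.
   Context: An automaton is a triple $\mathcal{A}=(Q,\Sigma,\delta)$ with a finite state set $Q$, a finite nonempty alphabet $\Sigma$ (events), and $\delta\colon Q\times\Sigma\to 2^Q$, extended to $2^Q\times\Sigma^*$ as usual. The alphabet is partitioned into observable events $\Sigma_o$ and unobservable events; $P\colon\Sigma^*\to\Sigma_o^*$ is the morphism erasing the unobservable events. For $s,t\in Q$, $L_m(\mathcal{A},s,t)=\{w\in\Sigma^*\mid t\in\delta(s,w)\}$. IFO: $\mathcal{A}$ is initial-and-final-state opaque (IFO) with respect to sets $Q_S,Q_{NS}\subseteq Q\times Q$ of secret and nonsecret pairs and $P$ if for every $(s,t)\in Q_S$ and every $w\in L_m(\mathcal{A},s,t)$ there are $(s',t')\in Q_{NS}$ and $w'\in L_m(\mathcal{A},s',t')$ with $P(w)=P(w')$. Projected automaton: $P(\mathcal{A})$ is the automaton over $\Sigma_o$ with the same states as $\mathcal{A}$, obtained by replacing each transition $(q,a,r)$ by $(q,P(a),r)$ and eliminating $\varepsilon$-transitions. Semigroup: for an automaton with $n$ states, each event $a$ defines the $n\times n$ binary matrix $(a_{ij})$ with $a_{ij}=1$ iff $j\in\delta(i,a)$. $\mathcal{B}_{\mathcal{A}}$ is the semigroup of all finite products of the matrices of the events under boolean matrix multiplication (addition replaced by maximum). Algorithm 1 (input: $\mathcal{A}$, $Q_S,Q_{NS}\subseteq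 Q\times Q$, $\Sigma_o\subseteq\Sigma$; output: true iff $\mathcal{A}$ is IFO with respect to $Q_S$, $Q_{NS}$, $P$): construct $P(\mathcal{A})$; compute the elements of $\mathcal{B}_{P(\mathcal{A})}$ one by one; for every newly generated element $(w_{ij})$ and every $(s,f)\in Q_S$, if $w_{sf}=1$ and there is no $(s',f')\in Q_{NS}$ with $w_{s'f'}=1$, return false; after all elements have been processed, return true. *)

theory Defs
  imports Main
begin

record ('q, 'e) automaton =
  states :: "'q set"
  events :: "'e set"
  trans :: "'q \<Rightarrow> 'e \<Rightarrow> 'q set"

definition is_automaton :: "('q, 'e) automaton \<Rightarrow> bool" where
  "is_automaton A \<longleftrightarrow>
     finite (states A) \<and> finite (events A) \<and> events A \<noteq> {} \<and>
     (\<forall>q\<in>states A. \<forall>a\<in>events A. trans A q a \<subseteq> states A)"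

fun trans_word :: "('q, 'e) automaton \<Rightarrow> 'q set \<Rightarrow> 'e list \<Rightarrow> 'q set" where
  "trans_word A S [] = S"
| "trans_word A S (a # w) = trans_word A (\<Union>q\<in>S. trans A q a) w"

definition lang :: "('q, 'e) automaton \<Rightarrow> 'q \<Rightarrow> 'q \<Rightarrow> 'e list set" where
  "lang A s t = {w \<in> lists (events A). t \<in> trans_word A {s} w}"

definition proj :: "'e set \<Rightarrow> 'e list \<Rightarrow> 'e list" where
  "proj \<Sigma>\<^sub>o w = filter (\<lambda>a. a \<in> \<Sigma>\<^sub>o) w"

definition IFO :: "('q, 'e) automaton \<Rightarrow> ('q \<times> 'q) set \<Rightarrow> ('q \<times> 'q) set \<Rightarrow> 'e set \<Rightarrow> bool" where
  "IFO A Q\<^sub>S Q\<^sub>N\<^sub>S \<Sigma>\<^sub>o \<longleftrightarrow>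
     (\<forall>(s, t)\<in>Q\<^sub>S. \<forall>w\<in>lang A s t.
        \<exists>(s', t')\<in>Q\<^sub>N\<^sub>S. \<exists>w'\<in>lang A s' t'. proj \<Sigma>\<^sub>o w = proj \<Sigma>\<^sub>o w')"

text \<open>The transitions that become \<open>\<epsilon>\<close>-transitions under the projection.\<close>

definition eps_trans :: "('q, 'e) automaton \<Rightarrow> 'e set \<Rightarrow> ('q \<times> 'q) set" where
  "eps_trans A \<Sigma>\<^sub>o = {(q, r). q \<in> states A \<and> (\<exists>a\<in>events A - \<Sigma>\<^sub>o. r \<in> trans A q a)}"

text \<open>
  The \<open>\<epsilon>\<close>-transitions are eliminated by taking the \<open>\<epsilon>\<close>-closure both before and after an
  observable transition; since any pair of states may serve as start and end of a word,
  closing on one side only would lose projected words.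
\<close>

definition proj_automaton :: "('q, 'e) automaton \<Rightarrow> 'e set \<Rightarrow> ('q, 'e) automaton" where
  "proj_automaton A \<Sigma>\<^sub>o =
     \<lparr>states = states A,
      events = \<Sigma>\<^sub>o,
      trans = (\<lambda>q a. {r. \<exists>p p'. (q, p) \<in> (eps_trans A \<Sigma>\<^sub>o)\<^sup>* \<and> p' \<in> trans A p a \<and>
                               (p', r) \<in> (eps_trans A \<Sigma>\<^sub>o)\<^sup>*})\<rparr>"

text \<open>
  Binary matrices are indexed by the states of the automaton. All entries outside
  \<open>states A \<times> states A\<close> are \<open>0\<close>, so that equality of functions is equality of matrices.
\<close>

type_synonym 'q bmat = "'q \<Rightarrow> 'q \<Rightarrow> nat"

definition event_mat :: "('q, 'e) automaton \<Rightarrow> 'e \<Rightarrow> 'q bmat" where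
  "event_mat A a =
     (\<lambda>i j. if i \<in> states A \<and> j \<in> states A \<and> j \<in> trans A i a then 1 else 0)"

definition bmat_mult :: "'q set \<Rightarrow> 'q bmat \<Rightarrow> 'q bmat \<Rightarrow> 'q bmat" where
  "bmat_mult Q M N =
     (\<lambda>i j. if i \<in> Q \<and> j \<in> Q then Max ((\<lambda>k. M i k * N k j) ` Q) else 0)"

inductive_set bsemigroup :: "('q, 'e) automaton \<Rightarrow> 'q bmat set" for A where
  generator: "a \<in> events A \<Longrightarrow> event_mat A a \<in> bsemigroup A"
| product: "M \<in> bsemigroup A \<Longrightarrow> N \<in> bsemigroup A \<Longrightarrow>
            bmat_mult (states A) M N \<in> bsemigroup A"

definition violates :: "('q \<times> 'q) set \<Rightarrow> ('q \<times> 'q) set \<Rightarrow> 'q bmat \<Rightarrow> bool" where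
  "violates Q\<^sub>S Q\<^sub>N\<^sub>S M \<longleftrightarrow>
     (\<exists>(s, f)\<in>Q\<^sub>S. M s f = 1 \<and> \<not> (\<exists>(s', f')\<in>Q\<^sub>N\<^sub>S. M s' f' = 1))"

text \<open>
  \<open>alg_loop B Q\<^sub>S Q\<^sub>N\<^sub>S X b k\<close>: with exactly the elements of \<open>X\<close> already processed, some
  execution of the main loop returns \<open>b\<close> after \<open>k\<close> further steps. The elements of the
  semigroup \<open>B\<close> may be generated in any order. Generating and testing one new element
  counts as a single step and nothing else is counted, so \<open>k\<close> is a lower bound on the cost
  under any finer cost measure.
\<close>

inductive alg_loop ::
  "'q bmat set \<Rightarrow> ('q \<times> 'q) set \<Rightarrow> ('q \<times> 'q) set \<Rightarrow> 'q bmat set \<Rightarrow> bool \<Rightarrow> nat \<Rightarrow> bool"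
  for B Q\<^sub>S Q\<^sub>N\<^sub>S where
  finished: "B \<subseteq> X \<Longrightarrow> alg_loop B Q\<^sub>S Q\<^sub>N\<^sub>S X True 0"
| reject: "M \<in> B - X \<Longrightarrow> violates Q\<^sub>S Q\<^sub>N\<^sub>S M \<Longrightarrow> alg_loop B Q\<^sub>S Q\<^sub>N\<^sub>S X False 1"
| continue: "M \<in> B - X \<Longrightarrow> \<not> violates Q\<^sub>S Q\<^sub>N\<^sub>S M \<Longrightarrow>
             alg_loop B Q\<^sub>S Q\<^sub>N\<^sub>S (insert M X) b k \<Longrightarrow> alg_loop B Q\<^sub>S Q\<^sub>N\<^sub>S X b (Suc k)"

definition ifo_alg ::
  "('q, 'e) automaton \<Rightarrow> ('q \<times> 'q) set \<Rightarrow> ('q \<times> 'q) set \<Rightarrow> 'e set \<Rightarrow> bool \<Rightarrow> nat \<Rightarrow> bool" where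
  "ifo_alg A Q\<^sub>S Q\<^sub>N\<^sub>S \<Sigma>\<^sub>o b k \<longleftrightarrow>
     alg_loop (bsemigroup (proj_automaton A \<Sigma>\<^sub>o)) Q\<^sub>S Q\<^sub>N\<^sub>S {} b k"

text \<open>
  Some execution terminates, and every terminating execution takes at least \<open>m\<close> steps.
\<close>

definition ifo_alg_needs ::
  "('q, 'e) automaton \<Rightarrow> ('q \<times> 'q) set \<Rightarrow> ('q \<times> 'q) set \<Rightarrow> 'e set \<Rightarrow> nat \<Rightarrow> bool" where
  "ifo_alg_needs A Q\<^sub>S Q\<^sub>N\<^sub>S \<Sigma>\<^sub>o m \<longleftrightarrow>
     (\<exists>b k. ifo_alg A Q\<^sub>S Q\<^sub>N\<^sub>S \<Sigma>\<^sub>o b k) \<and> (\<forall>b k. ifo_alg A Q\<^sub>S Q\<^sub>N\<^sub>S \<Sigma>\<^sub>o b k \<longrightarrow> m \<le> k)"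

end

(*
  Let the events be all 2^(n^2) binary relations on n states, each acting as itself. Their
  matrices are pairwise distinct and, being all binary n x n matrices, already closed under
  products, so the semigroup has exactly 2^(n^2) elements. If the automaton is opaque, then no
  matrix of an event a is a witness of a violation, because with every event observable the only
  word projecting to the one-letter word a is that word itself. Hence the loop never returns
  early and has to process every element.
*)
theory Submission
  imports Defs
begin

text \<open>Without unobservable events there are no \<epsilon>-transitions, so both closures are
  the identity.\<close>

lemma proj_automaton_all_observable:
  "proj_automaton A (events A) = \<lparr>states = states A, events = events A, trans = trans A\<rparr>"
proof -
  have "eps_trans A (events A) = {}"
    by (auto simp: eps_trans_def)
  then show ?thesis
    by (simp add: proj_automaton_def)
qed

text \<open>Any unprocessed element may be taken next, and each \<open>continue\<close> step shrinks
  \<open>B - X\<close> by exactly one. This supplies the terminating execution that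
  \<open>ifo_alg_needs\<close> asks for.\<close>

lemma alg_loop_completes:
  assumes "finite B" and "\<And>M. M \<in> B \<Longrightarrow> \<not> violates Q\<^sub>S Q\<^sub>N\<^sub>S M"
  shows "alg_loop B Q\<^sub>S Q\<^sub>N\<^sub>S X True (card (B - X))"
proof (induction "card (B - X)" arbitrary: X)
  case 0
  then have "B \<subseteq> X"
    using \<open>finite B\<close> by auto
  then show ?case
    by (metis "0" alg_loop.finished)
next
  case (Suc k)
  then obtain M where M: "M \<in> B - X"
    by (metis card.empty ex_in_conv nat.distinct(1))
  have "B - insert M X = (B - X) - {M}"
    by auto
  with M Suc.hyps(2) \<open>finite B\<close> have "k = card (B - insert M X)"
    by (simp add: card_Diff_singleton)
  with Suc.hyps(1) have "alg_loop B Q\<^sub>S Q\<^sub>N\<^sub>S (insert M X) True k"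
    by blast
  with M assms(2) have "alg_loop B Q\<^sub>S Q\<^sub>N\<^sub>S X True (Suc k)"
    by (blast intro: alg_loop.continue)
  with Suc.hyps(2) show ?case
    by simp
qed

text \<open>The rule \<open>reject\<close> can never fire, so an execution ends only once
  \<open>B\<close> is exhausted, and each step removes at most one element from
  \<open>B - X\<close>.\<close>

lemma alg_loop_lower_bound:
  assumes "alg_loop B Q\<^sub>S Q\<^sub>N\<^sub>S X b k"
    and "finite B" and "\<And>M. M \<in> B \<Longrightarrow> \<not> violates Q\<^sub>S Q\<^sub>N\<^sub>S M"
  shows "card (B - X) \<le> k"
  using assms(1)
proof induction
  case (finished X)
  then show ?case
    by (simp add: Diff_eq_empty_iff[THEN iffD2])
next
  case (reject M X)
  then show ?case
    using assms(3) by blast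
next
  case (continue M X b k)
  have "B - X = insert M (B - insert M X)"
    using continue.hyps(1) by blast
  then have "card (B - X) \<le> Suc (card (B - insert M X))"
    by (metis card_insert_le_m1 diff_Suc_1 le_refl zero_less_Suc)
  with continue.IH show ?case
    by simp
qed

lemma IFO_not_violates_event_mat:
  assumes "IFO A Q\<^sub>S Q\<^sub>N\<^sub>S (events A)" and "Q\<^sub>N\<^sub>S \<subseteq> states A \<times> states A" and "a \<in> events A"
  shows "\<not> violates Q\<^sub>S Q\<^sub>N\<^sub>S (event_mat A a)"
proof
  assume "violates Q\<^sub>S Q\<^sub>N\<^sub>S (event_mat A a)"
  then obtain s f where sf: "(s, f) \<in> Q\<^sub>S" "event_mat A a s f = 1"
    and none: "\<And>s' f'. (s', f') \<in> Q\<^sub>N\<^sub>S \<Longrightarrow> event_mat A a s' f' \<noteq> 1"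
    by (auto simp: violates_def)
  have "[a] \<in> lang A s f"
    using sf(2) assms(3) by (auto simp: lang_def event_mat_def split: if_splits)
  with assms(1) sf(1) obtain s' f' w' where s'f': "(s', f') \<in> Q\<^sub>N\<^sub>S" "w' \<in> lang A s' f'"
    and "proj (events A) [a] = proj (events A) w'"
    unfolding IFO_def by fast
  \<comment> \<open>Words in \<open>lang\<close> use only events of \<open>A\<close>, all observable
    here, so the projection erases nothing.\<close>
  moreover have "proj (events A) w' = w'"
    using s'f'(2) by (auto simp: lang_def proj_def intro: filter_True)
  ultimately have "w' = [a]"
    using assms(3) by (simp add: proj_def)
  with s'f' have "f' \<in> trans A s' a"
    by (simp add: lang_def)
  \<comment> \<open>Entries outside \<open>states A \<times> states A\<close> are 0, hence the
    appeal to the bound on \<open>Q\<^sub>N\<^sub>S\<close>.\<close>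
  with s'f'(1) assms(2) have "event_mat A a s' f' = 1"
    by (auto simp: event_mat_def)
  with none s'f'(1) show False
    by blast
qed

lemma event_mat_le_1: "event_mat A a i j \<le> 1"
  by (simp add: event_mat_def)

lemma bmat_mult_le_1:
  assumes "finite Q" and "\<And>i j. M i j \<le> 1" and "\<And>i j. N i j \<le> 1"
  shows "bmat_mult Q M N i j \<le> 1"
proof (cases "i \<in> Q \<and> j \<in> Q")
  case True
  moreover have "M i k * N k j \<le> 1" for k
    using mult_le_mono[OF assms(2,3)] by simp
  \<comment> \<open>Here \<open>i \<in> Q\<close> makes the set under \<open>Max\<close>
    nonempty.\<close>
  ultimately show ?thesis
    using assms(1) by (auto simp: bmat_mult_def intro!: Max.boundedI)
qed (auto simp: bmat_mult_def)

text \<open>A product of binary matrices is binary, hence determined by its support, and some event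
  realizes that support as a relation. So the generators are already closed under products.\<close>

lemma bsemigroup_universal:
  assumes fin: "finite (states A)"
    and univ: "\<And>R. R \<subseteq> states A \<times> states A \<Longrightarrow>
                 \<exists>a\<in>events A. \<forall>q\<in>states A. trans A q a = R `` {q}"
  shows "bsemigroup A = event_mat A ` events A"
proof
  show "event_mat A ` events A \<subseteq> bsemigroup A"
    by (auto intro: bsemigroup.generator)
next
  show "bsemigroup A \<subseteq> event_mat A ` events A"
  proof
    fix M assume "M \<in> bsemigroup A"
    then show "M \<in> event_mat A ` events A"
    proof induction
      case (generator a)
      then show ?case by blast
    next
      case (product M N)
      define K where "K = bmat_mult (states A) M N"
      \<comment> \<open>The support of the product; the event acting as \<open>R\<close> has
        \<open>K\<close> as its matrix.\<close>
      define R where "R = {(i, j). i \<in> states A \<and> j \<in> states A \<and> K i j = 1}"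
      have "R \<subseteq> states A \<times> states A"
        by (auto simp: R_def)
      then obtain a where a: "a \<in> events A" "\<forall>q\<in>states A. trans A q a = R `` {q}"
        using univ by blast
      have "K i j \<le> 1" for i j
        unfolding K_def using product.IH fin
        by (intro bmat_mult_le_1) (auto simp: event_mat_le_1[simplified])
      then have "K i j = 0 \<or> K i j = 1" for i j
        by (metis le_Suc_eq le_zero_eq One_nat_def)
      moreover have "K i j = 0" if "\<not> (i \<in> states A \<and> j \<in> states A)" for i j
        using that by (auto simp: K_def bmat_mult_def)
      ultimately have "K i j = event_mat A a i j" for i j
        using a(2) by (auto simp: event_mat_def R_def)
      then have "K = event_mat A a"
        by blast
      with a(1) show ?case
        by (auto simp: K_def)
    qed
  qed
qed

theorem theorem1:
  fixes n :: nat
  assumes "n \<ge> 1"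
  shows "\<exists>A :: (nat, nat) automaton.
    is_automaton A \<and> card (states A) = n \<and> card (events A) = 2 ^ (n ^ 2) \<and>
    (\<exists>Q\<^sub>S Q\<^sub>N\<^sub>S. Q\<^sub>S \<noteq> {} \<and> Q\<^sub>S \<subseteq> states A \<times> states A \<and> Q\<^sub>N\<^sub>S \<subseteq> states A \<times> states A \<and>
       IFO A Q\<^sub>S Q\<^sub>N\<^sub>S (events A)) \<and>
    (\<forall>Q\<^sub>S Q\<^sub>N\<^sub>S. Q\<^sub>S \<subseteq> states A \<times> states A \<longrightarrow> Q\<^sub>N\<^sub>S \<subseteq> states A \<times> states A \<longrightarrow>
       IFO A Q\<^sub>S Q\<^sub>N\<^sub>S (events A) \<longrightarrow>
       ifo_alg_needs A Q\<^sub>S Q\<^sub>N\<^sub>S (events A) (2 ^ (n ^ 2)))"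
proof -
  define Q where "Q = {..<n}"
  define E where "E = {..<(2::nat) ^ (n ^ 2)}"
  have "card E = card (Pow (Q \<times> Q))"
    by (simp add: E_def Q_def card_Pow card_cartesian_product power2_eq_square)
  \<comment> \<open>Events must be numbers, so \<open>g\<close> decodes each number below
    \<open>2 ^ (n ^ 2)\<close> into the relation by which it acts.\<close>
  then obtain g where g: "bij_betw g E (Pow (Q \<times> Q))"
    using finite_same_card_bij[of E "Pow (Q \<times> Q)"] by (auto simp: E_def Q_def)
  define A :: "(nat, nat) automaton"
    where "A = \<lparr>states = Q, events = E, trans = (\<lambda>q a. g a `` {q})\<rparr>"
  have A_simps [simp]: "states A = Q" "events A = E" "trans A q a = g a `` {q}" for q a
    by (simp_all add: A_def)
  have proj_A: "proj_automaton A E = A"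
    using proj_automaton_all_observable[of A] by (simp add: A_def)
  have g_sub: "g a \<subseteq> Q \<times> Q" if "a \<in> E" for a
    using g that by (auto simp: bij_betw_def)
  have aut: "is_automaton A"
    using g_sub by (auto simp: is_automaton_def E_def Q_def lessThan_empty_iff)
  \<comment> \<open>With every pair both secret and nonsecret, each word is its own witness. This
    instance keeps the lower bound from being vacuous.\<close>
  have IFO_all: "IFO A (Q \<times> Q) (Q \<times> Q) E"
    unfolding IFO_def by fast
  have B: "bsemigroup A = event_mat A ` E"
  proof -
    have "\<exists>a\<in>E. \<forall>q\<in>Q. g a `` {q} = R `` {q}" if "R \<subseteq> Q \<times> Q" for R
      using g that by (metis PowI bij_betw_iff_bijections)
    then show ?thesis
      using bsemigroup_universal[of A] by (simp add: Q_def)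
  qed
  have "inj_on (event_mat A) E"
  proof
    fix a b assume ab: "a \<in> E" "b \<in> E" and eq: "event_mat A a = event_mat A b"
    \<comment> \<open>The matrix determines the relation because \<open>g c\<close> has no pairs
      outside \<open>Q \<times> Q\<close>, where the entries are 0.\<close>
    have entry: "(i, j) \<in> g c \<longleftrightarrow> event_mat A c i j = 1" if "c \<in> E" for c i j
      using g_sub[OF that] by (auto simp: event_mat_def)
    have "(i, j) \<in> g a \<longleftrightarrow> (i, j) \<in> g b" for i j
      using entry ab eq by simp
    then have "g a = g b"
      by auto
    then show "a = b"
      using g ab by (auto simp: bij_betw_def dest: inj_onD)
  qed
  then have card_B: "card (bsemigroup A) = 2 ^ (n ^ 2)"
    by (simp add: B card_image E_def)
  have fin_B: "finite (bsemigroup A)"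
    by (simp add: B E_def)
  have needs: "ifo_alg_needs A Q\<^sub>S Q\<^sub>N\<^sub>S E (2 ^ (n ^ 2))"
    if "Q\<^sub>N\<^sub>S \<subseteq> Q \<times> Q" "IFO A Q\<^sub>S Q\<^sub>N\<^sub>S E" for Q\<^sub>S Q\<^sub>N\<^sub>S
  proof -
    have no_viol: "\<not> violates Q\<^sub>S Q\<^sub>N\<^sub>S M" if "M \<in> bsemigroup A" for M
      using that IFO_not_violates_event_mat[of A Q\<^sub>S Q\<^sub>N\<^sub>S] \<open>Q\<^sub>N\<^sub>S \<subseteq> Q \<times> Q\<close> \<open>IFO A Q\<^sub>S Q\<^sub>N\<^sub>S E\<close>
      by (auto simp: B)
    show ?thesis
      unfolding ifo_alg_needs_def ifo_alg_def proj_A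
      \<comment> \<open>The algorithm starts with nothing processed, so both bounds are taken at the
        empty set, where \<open>B - X\<close> is the whole semigroup.\<close>
      using alg_loop_completes[OF fin_B no_viol]
        alg_loop_lower_bound[OF _ fin_B no_viol, where X = "{}"] card_B
      by (metis Diff_empty)
  qed
  \<comment> \<open>The assumption \<open>n \<ge> 1\<close> enters here, to make the secret set
    nonempty.\<close>
  have "Q \<times> Q \<noteq> {}"
    using assms by (auto simp: Q_def lessThan_empty_iff)
  then have "\<exists>Q\<^sub>S Q\<^sub>N\<^sub>S. Q\<^sub>S \<noteq> {} \<and> Q\<^sub>S \<subseteq> states A \<times> states A \<and> Q\<^sub>N\<^sub>S \<subseteq> states A \<times> states A \<and>
       IFO A Q\<^sub>S Q\<^sub>N\<^sub>S (events A)"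
    using IFO_all by (intro exI[of _ "Q \<times> Q"]) simp
  moreover have "card (states A) = n" "card (events A) = 2 ^ (n ^ 2)"
    by (simp_all add: Q_def E_def)
  ultimately show ?thesis
    using aut needs by (intro exI[of _ A] conjI allI impI) (simp_all only: A_simps)
qed

end
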